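(* Let $a>0$ and $b>0$ be real constants, let $f\in L^1_{loc}([0,\infty);\mathbb{R})$, let $\xi_0,\xi_1\in\mathbb{R}$, and let $x$ be the unique continuous solution on $[0,\infty)$ of $$x''(t)+ax'(t)+bx(t)=f(t),\quad t\ge 0;\qquad x(0)=\xi_0,\ x'(0)=\xi_1.$$ Let $y_2(t)=\int_0^t (t-s)e^{-(t-s)}f(s)\,ds$ for $t\ge 0$, and define $$\bar X=\limsup_{t\to\infty}|x(t)|\in[0,\infty],\qquad \bar Y_2=\limsup_{t\to\infty}|y_2(t)|\in[0,\infty].$$ Then: (i) If $\bar Y_2=0$, then $\bar X=0$. (ii) If $\bar Y_2\in(0,\infty)$, then $\bar X\in(0,\infty)$. (iii) If $\bar Y_2=+\infty$, then $\bar X=+\infty$.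
   Context: Since $f$ is only locally integrable, a solution of the differential equation is a function $x\in C^1([0,\infty);\mathbb{R})$ with $x'$ locally absolutely continuous, satisfying the equation for almost every $t\ge 0$ and the given initial conditions. *)

theory Defs
  imports "HOL-Analysis.Analysis"
begin

definition locally_integrable_halfline :: "(real \<Rightarrow> real) \<Rightarrow> bool" where
  "locally_integrable_halfline f \<longleftrightarrow> (\<forall>T\<ge>0. set_integrable lebesgue {0..T} f)"

(* A finite family of non-overlapping closed intervals [u, v] is encoded as a finite set of
   pairs (u, v); intervals that share only an endpoint are allowed, and degenerate intervals
   contribute nothing to either sum. *)
definition absolutely_continuous_on :: "real set \<Rightarrow> (real \<Rightarrow> real) \<Rightarrow> bool" where
  "absolutely_continuous_on S g \<longleftrightarrow>
    (\<forall>\<epsilon>>0. \<exists>\<delta>>0. \<forall>P :: (real \<times> real) set.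
      finite P \<longrightarrow> (\<forall>(u, v)\<in>P. u \<le> v \<and> {u..v} \<subseteq> S) \<longrightarrow>
      disjoint_family_on (\<lambda>(u, v). {u<..<v}) P \<longrightarrow>
      (\<Sum>(u, v)\<in>P. v - u) < \<delta> \<longrightarrow> (\<Sum>(u, v)\<in>P. \<bar>g v - g u\<bar>) < \<epsilon>)"

(* Functions are total, so only their restrictions to [0, \<infinity>) matter: derivatives are taken
   within {0..}, hence one-sided at 0. *)
definition solves_ode ::
  "real \<Rightarrow> real \<Rightarrow> (real \<Rightarrow> real) \<Rightarrow> real \<Rightarrow> real \<Rightarrow> (real \<Rightarrow> real) \<Rightarrow> bool" where
  "solves_ode a b f \<xi>0 \<xi>1 x \<longleftrightarrow>
    (\<exists>x'. (\<forall>t\<ge>0. (x has_real_derivative x' t) (at t within {0..})) \<and>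
          continuous_on {0..} x' \<and>
          (\<forall>T\<ge>0. absolutely_continuous_on {0..T} x') \<and>
          (AE t\<in>{0..} in lebesgue. \<exists>x''. (x' has_real_derivative x'') (at t within {0..}) \<and>
             x'' + a * x' t + b * x t = f t) \<and>
          x 0 = \<xi>0 \<and> x' 0 = \<xi>1)"

definition y2 :: "(real \<Rightarrow> real) \<Rightarrow> real \<Rightarrow> real" where
  "y2 f t = (LINT s:{0..t}|lebesgue. (t - s) * exp (- (t - s)) * f s)"

definition limsup_abs :: "(real \<Rightarrow> real) \<Rightarrow> ereal" where
  "limsup_abs g = Limsup at_top (\<lambda>t. ereal \<bar>g t\<bar>)"

end

(* The kernel of y2 is t exp(-t), whose symbol is (D + 1)^-2.  Put q = (t exp(-t)) * x, a C^2 function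
   with q'' + 2 q' + q = x and q(0) = q'(0) = 0.  Integrating the equation for x against the kernel,
   twice by parts, gives y2 = q'' + a q' + b q - d, where d(t) -> 0 comes from the initial data.
   So q is the response of a classical damped oscillator to x, and of another one to y2 + d.  For
   each of them q and q' are eventually bounded by a constant times any eventual bound of the
   forcing, and x and y2 + d differ only by a combination of q and q'. *)
theory Submission
  imports Defs "HOL-Real_Asymp.Real_Asymp"
begin

section \<open>The fundamental theorem of calculus for absolutely continuous functions\<close>

text \<open>The pieces tagged in \<open>N\<close> lie in \<open>U\<close> and overlap only in null
  sets, so their lengths add up to less than \<open>\<delta>\<close>. Read as pairs of endpoints
  they form an admissible family for absolute continuity.\<close>

lemma sum_tagged_negligible_small:
  fixes g :: "real \<Rightarrow> real"
  assumes p: "p tagged_division_of {a..b}"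
    and U: "open U" "U \<in> lmeasurable" "measure lebesgue U < \<delta>"
    and inU: "\<And>x K. (x, K) \<in> p \<Longrightarrow> x \<in> N \<Longrightarrow> K \<subseteq> U"
    and ac: "\<And>P. finite P \<Longrightarrow> (\<forall>(u, v)\<in>P. u \<le> v \<and> {u..v} \<subseteq> {a..b}) \<Longrightarrow>
      disjoint_family_on (\<lambda>(u, v). {u<..<v}) P \<Longrightarrow>
      (\<Sum>(u, v)\<in>P. v - u) < \<delta> \<Longrightarrow> (\<Sum>(u, v)\<in>P. \<bar>g v - g u\<bar>) < \<epsilon>"
  shows "(\<Sum>(x, K)\<in>{(x, K)\<in>p. x \<in> N}. \<bar>g (Sup K) - g (Inf K)\<bar>) < \<epsilon>"
proof -
  let ?T = "{(x, K)\<in>p. x \<in> N}"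
  let ?e = "\<lambda>(x, K). (Inf K, Sup K) :: real \<times> real"
  note pD = tagged_division_ofD[OF p]
  have finT: "finite ?T"
    by (rule finite_subset[OF _ pD(1)]) auto
  have iv: "\<exists>u v. u \<le> v \<and> K = {u..v} \<and> x \<in> {u..v} \<and> {u..v} \<subseteq> {a..b} \<and> Inf K = u \<and> Sup K = v"
    if xK: "(x, K) \<in> p" for x K
  proof -
    obtain u v where K: "K = cbox u v" using pD(4)[OF xK] by blast
    then have "x \<in> {u..v}" "{u..v} \<subseteq> {a..b}" using pD(2,3)[OF xK] by auto
    then show ?thesis using K by (intro exI[of _ u] exI[of _ v]) auto
  qed
  have inj: "inj_on ?e ?T"
  proof (rule inj_onI, clarify)
    fix x K y L assume xK: "(x, K) \<in> p" and yL: "(y, L) \<in> p"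
      and eq: "Inf K = Inf L" "Sup K = Sup L"
    obtain u v where K: "u \<le> v" "K = {u..v}" "x \<in> {u..v}" "Inf K = u" "Sup K = v"
      using iv[OF xK] by blast
    obtain u' v' where L: "L = {u'..v'}" "y \<in> {u'..v'}" "Inf L = u'" "Sup L = v'"
      using iv[OF yL] by blast
    have KL: "K = L" using K L eq by simp
    \<comment> \<open>Distinct tags would force the common interval to have empty interior. It is
      then a single point, which contains both tags.\<close>
    moreover have "x = y"
    proof (rule ccontr)
      assume "x \<noteq> y"
      then have "interior K \<inter> interior L = {}" using pD(5)[OF xK yL] by auto
      then have "interior {u..v} = {}" using KL K(2) by simp
      then show False using \<open>x \<noteq> y\<close> K L eq by auto
    qed
    ultimately show "x = y \<and> K = L" by simp
  qed
  have disj: "disjoint_family_on (\<lambda>(u, v). {u<..<v}) (?e ` ?T)"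
    unfolding disjoint_family_on_def
  proof (intro ballI impI)
    fix z w assume "z \<in> ?e ` ?T" "w \<in> ?e ` ?T" and ne: "z \<noteq> w"
    then obtain x K y L where xK: "(x, K) \<in> p" and yL: "(y, L) \<in> p"
      and zw: "z = (Inf K, Sup K)" "w = (Inf L, Sup L)" by auto
    have "interior K \<inter> interior L = {}" using pD(5)[OF xK yL] ne zw by auto
    moreover obtain u v where "K = {u..v}" "Inf K = u" "Sup K = v" using iv[OF xK] by blast
    moreover obtain u' v' where "L = {u'..v'}" "Inf L = u'" "Sup L = v'" using iv[OF yL] by blast
    ultimately show "(case z of (u, v) \<Rightarrow> {u<..<v}) \<inter> (case w of (u, v) \<Rightarrow> {u<..<v}) = {}"
      using zw by simp
  qed
  have len: "(\<Sum>(u, v)\<in>?e ` ?T. v - u) < \<delta>"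
  proof -
    have "(\<Sum>(u, v)\<in>?e ` ?T. v - u) = (\<Sum>z\<in>?T. measure lebesgue (snd z))"
      unfolding sum.reindex[OF inj]
    proof (rule sum.cong[OF refl], clarsimp)
      fix x K assume "(x, K) \<in> p"
      from iv[OF this] show "Sup K - Inf K = measure lebesgue K" by force
    qed
    also have "\<dots> = measure lebesgue (\<Union>(snd ` ?T))"
    proof (rule measure_negligible_finite_Union_image[OF finT, symmetric])
      show "snd z \<in> lmeasurable" if z: "z \<in> ?T" for z
      proof -
        obtain x K where zxK: "z = (x, K)" "(x, K) \<in> p" using z by auto
        obtain u v where "K = {u..v}" using iv[OF zxK(2)] by blast
        then show ?thesis using zxK by simp
      qed
      show "pairwise (\<lambda>x y. negligible (snd x \<inter> snd y)) ?T"
        unfolding pairwise_def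
      proof clarsimp
        fix x K y L assume xK: "(x, K) \<in> p" and yL: "(y, L) \<in> p" and ne: "x = y \<longrightarrow> K \<noteq> L"
        have "interior (K \<inter> L) = {}" using pD(5)[OF xK yL] ne by auto
        moreover have "convex (K \<inter> L)"
          using iv[OF xK] iv[OF yL] by (metis convex_Int convex_real_interval(5))
        ultimately show "negligible (K \<inter> L)"
          using negligible_convex_interior by blast
      qed
    qed
    also have "\<dots> \<le> measure lebesgue U"
    proof (rule measure_mono_fmeasurable)
      show "\<Union>(snd ` ?T) \<subseteq> U" using inU by fastforce
      show "\<Union>(snd ` ?T) \<in> sets lebesgue"
      proof (rule sets.finite_Union)
        show "snd ` ?T \<subseteq> sets lebesgue"
        proof clarsimp
          fix x K assume "(x, K) \<in> p"
          from iv[OF this] show "K \<in> sets lebesgue" by force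
        qed
      qed (use finT in auto)
    qed (use U in auto)
    finally show ?thesis using U by simp
  qed
  have "(\<Sum>(u, v)\<in>?e ` ?T. \<bar>g v - g u\<bar>) < \<epsilon>"
  proof (rule ac)
    show "\<forall>(u, v)\<in>?e ` ?T. u \<le> v \<and> {u..v} \<subseteq> {a..b}"
    proof clarify
      fix x K assume "(x, K) \<in> p"
      from iv[OF this] show "Inf K \<le> Sup K \<and> {Inf K..Sup K} \<subseteq> {a..b}" by force
    qed
  qed (use finT disj len in auto)
  then show ?thesis
    unfolding sum.reindex[OF inj] by (simp add: case_prod_unfold o_def)
qed

text \<open>Cover \<open>N\<close> by a small open set \<open>U\<close> and let the gauge at the tags in \<open>N\<close> be \<open>U\<close>: absolute
  continuity controls exactly the contribution of these tags to the Henstock sum.\<close>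

theorem absolutely_continuous_has_integral:
  fixes g h :: "real \<Rightarrow> real"
  assumes "a \<le> b" and ac: "absolutely_continuous_on {a..b} g" and N: "negligible N"
    and der: "\<And>t. t \<in> {a..b} - N \<Longrightarrow> (g has_real_derivative h t) (at t within {a..b})"
  shows "(h has_integral g b - g a) {a..b}"
proof -
  \<comment> \<open>With value 0 on \<open>N\<close>, the error of a piece tagged in
    \<open>N\<close> is just the increment of \<open>g\<close>, whatever \<open>h\<close> does
    there.\<close>
  let ?h = "\<lambda>t. if t \<in> N then 0 else h t"
  have "(?h has_integral g b - g a) {a..b}"
    unfolding has_integral_real
  proof (intro allI impI)
    fix e :: real assume "e > 0"
    \<comment> \<open>The errors at tags outside \<open>N\<close> sum to at most
      \<open>\<eta> * (b - a)\<close>. The added 1 keeps the denominator positive when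
      \<open>a = b\<close>.\<close>
    define \<eta> where "\<eta> = e / (2 * (b - a + 1))"
    have \<eta>: "\<eta> > 0" "\<eta> * (b - a) < e / 2"
      using \<open>e > 0\<close> \<open>a \<le> b\<close> by (auto simp: \<eta>_def field_simps)
    have "\<forall>x. \<exists>d>0. x \<in> {a..b} - N \<longrightarrow>
         (\<forall>y\<in>{a..b}. \<bar>y - x\<bar> < d \<longrightarrow> \<bar>g y - g x - (y - x) * h x\<bar> \<le> \<eta> * \<bar>y - x\<bar>)"
    proof
      fix x
      show "\<exists>d>0. x \<in> {a..b} - N \<longrightarrow>
         (\<forall>y\<in>{a..b}. \<bar>y - x\<bar> < d \<longrightarrow> \<bar>g y - g x - (y - x) * h x\<bar> \<le> \<eta> * \<bar>y - x\<bar>)"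
      proof (cases "x \<in> {a..b} - N")
        case True
        from der[OF this] show ?thesis
          using \<open>\<eta> > 0\<close>
          unfolding has_field_derivative_def has_derivative_within_alt
          by (auto simp: mult.commute)
      qed (auto intro: exI[of _ 1])
    qed
    then obtain d where d: "\<And>x. d x > 0" "\<And>x y. x \<in> {a..b} - N \<Longrightarrow> y \<in> {a..b} \<Longrightarrow>
        \<bar>y - x\<bar> < d x \<Longrightarrow> \<bar>g y - g x - (y - x) * h x\<bar> \<le> \<eta> * \<bar>y - x\<bar>"
      by metis
    have "e / 2 > 0" using \<open>e > 0\<close> by simp
    from ac[unfolded absolutely_continuous_on_def, THEN spec, THEN mp, OF this]
    obtain \<delta> where \<delta>: "\<delta> > 0" and ac': "\<forall>P :: (real \<times> real) set. finite P \<longrightarrow>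
        (\<forall>(u, v)\<in>P. u \<le> v \<and> {u..v} \<subseteq> {a..b}) \<longrightarrow> disjoint_family_on (\<lambda>(u, v). {u<..<v}) P \<longrightarrow>
        (\<Sum>(u, v)\<in>P. v - u) < \<delta> \<longrightarrow> (\<Sum>(u, v)\<in>P. \<bar>g v - g u\<bar>) < e / 2"
      by (elim exE conjE) (rule that)
    have "N \<in> sets lebesgue" using N negligible_imp_sets by blast
    from sets_lebesgue_outer_open[OF this \<delta>] obtain U where U: "open U" "N \<subseteq> U"
      "U - N \<in> lmeasurable" "emeasure lebesgue (U - N) < ennreal \<delta>" by metis
    \<comment> \<open>Outer regularity controls only \<open>U - N\<close>; adding back the null set
      \<open>N\<close> does not change the measure.\<close>
    have Umeas: "U \<in> lmeasurable" "measure lebesgue U < \<delta>"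
    proof -
      have eq: "U = (U - N) \<union> N" using U by auto
      show "U \<in> lmeasurable"
        by (subst eq) (intro fmeasurable.Un U negligible_imp_measurable N)
      have "measure lebesgue U \<le> measure lebesgue (U - N) + measure lebesgue N"
        by (subst eq, rule measure_Un_le) (use U N negligible_imp_sets in auto)
      also have "\<dots> < \<delta>"
        using U \<delta> negligible_imp_measure0[OF N]
        by (simp add: emeasure_eq_measure2 ennreal_less_iff fmeasurableD2 emeasure_eq_ennreal_measure)
      finally show "measure lebesgue U < \<delta>" .
    qed
    define \<gamma> where "\<gamma> = (\<lambda>x. if x \<in> N then U else ball x (d x))"
    show "\<exists>\<gamma>. gauge \<gamma> \<and> (\<forall>p. p tagged_division_of {a..b} \<and> \<gamma> fine p \<longrightarrow>
            norm ((\<Sum>(x, K)\<in>p. measure lborel K *\<^sub>R ?h x) - (g b - g a)) < e)"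
    proof (intro exI conjI allI impI; (elim conjE)?)
      show "gauge \<gamma>" using U d(1) by (auto simp: gauge_def \<gamma>_def)
      fix p assume p: "p tagged_division_of {a..b}" and fine: "\<gamma> fine p"
      note pD = tagged_division_ofD[OF p]
      have ba: "b - a = (\<Sum>(x,K)\<in>p. Sup K - Inf K)" "g b - g a = (\<Sum>(x,K)\<in>p. g (Sup K) - g (Inf K))"
        using additive_tagged_division_1[OF \<open>a \<le> b\<close>, of p "\<lambda>x. x"]
          additive_tagged_division_1[OF \<open>a \<le> b\<close>, of p g] p by auto
      have small: "(\<Sum>(x, K)\<in>{(x, K)\<in>p. x \<in> N}. \<bar>g (Sup K) - g (Inf K)\<bar>) < e / 2"
        by (rule sum_tagged_negligible_small[OF p U(1) Umeas _ ac'[THEN spec, THEN mp, THEN mp, THEN mp, THEN mp]])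
           (use fine in \<open>force simp: fine_def \<gamma>_def\<close>)
      have est: "\<bar>measure lborel K * ?h x - (g (Sup K) - g (Inf K))\<bar>
          \<le> \<eta> * (Sup K - Inf K) + (if x \<in> N then \<bar>g (Sup K) - g (Inf K)\<bar> else 0)"
        if xK: "(x, K) \<in> p" for x K
      proof -
        obtain u v where K: "K = cbox u v" using pD(4)[OF xK] by blast
        have x: "x \<in> {u..v}" "{u..v} \<subseteq> {a..b}" using pD(2,3)[OF xK] K by auto
        then have uv: "u \<le> v" "Inf K = u" "Sup K = v" using K by auto
        show ?thesis
        proof (cases "x \<in> N")
          case True
          have "0 \<le> \<eta> * (v - u)" using uv \<eta> by simp
          then show ?thesis using True uv by (simp add: abs_minus_commute)
        next
          case False
          have "K \<subseteq> ball x (d x)" using bspec[OF fine[unfolded fine_def] xK] False by (simp add: \<gamma>_def)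
          moreover have "u \<in> K" "v \<in> K" using K uv by auto
          ultimately have "\<bar>u - x\<bar> < d x" "\<bar>v - x\<bar> < d x" by (auto simp: dist_real_def)
          moreover have "x \<in> {a..b} - N" "u \<in> {a..b}" "v \<in> {a..b}" using x uv False by auto
          ultimately have "\<bar>g u - g x - (u - x) * h x\<bar> \<le> \<eta> * \<bar>u - x\<bar>"
            "\<bar>g v - g x - (v - x) * h x\<bar> \<le> \<eta> * \<bar>v - x\<bar>" using d(2) by blast+
          \<comment> \<open>Straddle argument: the tag lies between the endpoints, so the two
            linearization errors add up to at most \<open>\<eta> * (v - u)\<close>, with no loss
            from the distances to the tag.\<close>
          moreover have "\<bar>u - x\<bar> = x - u" "\<bar>v - x\<bar> = v - x" using x by auto
          moreover have "measure lborel K * h x - (g v - g u) =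
             (g u - g x - (u - x) * h x) - (g v - g x - (v - x) * h x)"
            using K uv by (simp add: algebra_simps)
          ultimately have "\<bar>measure lborel K * h x - (g v - g u)\<bar> \<le> \<eta> * (x - u) + \<eta> * (v - x)"
            by simp
          then show ?thesis using uv False by (simp add: algebra_simps)
        qed
      qed
      have "norm ((\<Sum>(x, K)\<in>p. measure lborel K *\<^sub>R ?h x) - (g b - g a))
          = \<bar>\<Sum>(x, K)\<in>p. measure lborel K * ?h x - (g (Sup K) - g (Inf K))\<bar>"
        unfolding ba(2) by (simp add: sum_subtractf case_prod_unfold)
      also have "\<dots> \<le> (\<Sum>(x, K)\<in>p. \<bar>measure lborel K * ?h x - (g (Sup K) - g (Inf K))\<bar>)"
        by (rule order_trans[OF sum_abs]) (simp add: case_prod_unfold)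
      also have "\<dots> \<le> (\<Sum>(x, K)\<in>p. \<eta> * (Sup K - Inf K) +
          (if x \<in> N then \<bar>g (Sup K) - g (Inf K)\<bar> else 0))"
        by (rule sum_mono) (use est in auto)
      also have "\<dots> = \<eta> * (b - a) + (\<Sum>(x, K)\<in>{(x, K)\<in>p. x \<in> N}. \<bar>g (Sup K) - g (Inf K)\<bar>)"
        unfolding ba(1)
        using sum.inter_filter[OF pD(1), of "\<lambda>z. \<bar>g (Sup (snd z)) - g (Inf (snd z))\<bar>" "\<lambda>z. fst z \<in> N"]
        by (simp add: sum.distrib sum_distrib_left case_prod_unfold)
      also have "\<dots> < e" using \<eta> small by linarith
      finally show "norm ((\<Sum>(x, K)\<in>p. measure lborel K *\<^sub>R ?h x) - (g b - g a)) < e" .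
    qed
  qed
  then show ?thesis
    by (rule has_integral_spike[OF N, rotated]) auto
qed

section \<open>Absolute continuity of products with a C^1 factor\<close>

text \<open>The extra term \<open>v - u\<close> is harmless: the total length of a family can itself
  be required to be small. Each of the two sums gets the budget
  \<open>\<epsilon> / (2 * K)\<close>.\<close>

lemma absolutely_continuous_on_dominated:
  assumes "absolutely_continuous_on S g" and "K > 0"
    and dom: "\<And>u v. u \<in> S \<Longrightarrow> v \<in> S \<Longrightarrow> u \<le> v \<Longrightarrow> \<bar>h v - h u\<bar> \<le> K * (\<bar>g v - g u\<bar> + (v - u))"
  shows "absolutely_continuous_on S h"
  unfolding absolutely_continuous_on_def
proof (intro allI impI)
  fix \<epsilon> :: real assume "\<epsilon> > 0"
  then have "\<epsilon> / (2 * K) > 0" using \<open>K > 0\<close> by simp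
  from assms(1)[unfolded absolutely_continuous_on_def, THEN spec, THEN mp, OF this]
  obtain \<delta> where "\<delta> > 0" and \<delta>: "\<forall>P :: (real \<times> real) set. finite P \<longrightarrow>
        (\<forall>(u, v)\<in>P. u \<le> v \<and> {u..v} \<subseteq> S) \<longrightarrow> disjoint_family_on (\<lambda>(u, v). {u<..<v}) P \<longrightarrow>
        (\<Sum>(u, v)\<in>P. v - u) < \<delta> \<longrightarrow> (\<Sum>(u, v)\<in>P. \<bar>g v - g u\<bar>) < \<epsilon> / (2 * K)"
    by (elim exE conjE) (rule that)
  show "\<exists>\<delta>>0. \<forall>P :: (real \<times> real) set. finite P \<longrightarrow>
        (\<forall>(u, v)\<in>P. u \<le> v \<and> {u..v} \<subseteq> S) \<longrightarrow> disjoint_family_on (\<lambda>(u, v). {u<..<v}) P \<longrightarrow>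
        (\<Sum>(u, v)\<in>P. v - u) < \<delta> \<longrightarrow> (\<Sum>(u, v)\<in>P. \<bar>h v - h u\<bar>) < \<epsilon>"
  proof (rule exI[of _ "min \<delta> (\<epsilon> / (2 * K))"], intro conjI allI impI)
    show "min \<delta> (\<epsilon> / (2 * K)) > 0" using \<open>\<delta> > 0\<close> \<open>\<epsilon> / (2 * K) > 0\<close> by simp
    fix P :: "(real \<times> real) set"
    assume P: "finite P" "\<forall>(u, v)\<in>P. u \<le> v \<and> {u..v} \<subseteq> S"
      "disjoint_family_on (\<lambda>(u, v). {u<..<v}) P" "(\<Sum>(u, v)\<in>P. v - u) < min \<delta> (\<epsilon> / (2 * K))"
    have "(\<Sum>(u, v)\<in>P. v - u) < \<delta>" using P(4) by simp
    then have g: "(\<Sum>(u, v)\<in>P. \<bar>g v - g u\<bar>) < \<epsilon> / (2 * K)"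
      by (rule \<delta>[THEN spec, THEN mp, THEN mp, THEN mp, THEN mp, OF P(1-3)])
    have "(\<Sum>(u, v)\<in>P. \<bar>h v - h u\<bar>) \<le> (\<Sum>(u, v)\<in>P. K * (\<bar>g v - g u\<bar> + (v - u)))"
    proof (rule sum_mono, clarify)
      fix u v assume "(u, v) \<in> P"
      then have "u \<le> v" "{u..v} \<subseteq> S" using P(2) by auto
      then show "\<bar>h v - h u\<bar> \<le> K * (\<bar>g v - g u\<bar> + (v - u))" by (intro dom) auto
    qed
    also have "\<dots> = K * ((\<Sum>(u, v)\<in>P. \<bar>g v - g u\<bar>) + (\<Sum>(u, v)\<in>P. v - u))"
      by (simp add: sum_distrib_left sum.distrib case_prod_unfold distrib_left)
    also have "\<dots> < K * (\<epsilon> / (2 * K) + \<epsilon> / (2 * K))"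
      using g P(4) \<open>K > 0\<close> by (intro mult_strict_left_mono add_strict_mono) auto
    also have "\<dots> = \<epsilon>" using \<open>K > 0\<close> by simp
    finally show "(\<Sum>(u, v)\<in>P. \<bar>h v - h u\<bar>) < \<epsilon>" .
  qed
qed

text \<open>An increment of the product splits into \<open>k v * (g v - g u)\<close> and
  \<open>(k v - k u) * g u\<close>. On a compact interval \<open>k\<close> and \<open>g\<close> are
  bounded and \<open>k\<close> is Lipschitz, so the domination lemma applies.\<close>

lemma absolutely_continuous_on_C1_mult:
  fixes g k k' :: "real \<Rightarrow> real"
  assumes g: "absolutely_continuous_on {a..b} g" "continuous_on {a..b} g"
    and k: "\<And>t. t \<in> {a..b} \<Longrightarrow> (k has_real_derivative k' t) (at t within {a..b})"
    and k': "continuous_on {a..b} k'"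
  shows "absolutely_continuous_on {a..b} (\<lambda>t. k t * g t)"
proof -
  have "continuous_on {a..b} k"
    by (rule DERIV_continuous_on[OF k])
  then have "bounded (k ` {a..b})" "bounded (k' ` {a..b})" "bounded (g ` {a..b})"
    using g k' by (auto intro: compact_imp_bounded compact_continuous_image)
  then obtain M1 M2 M3 where M: "M1 > 0" "M2 > 0" "M3 > 0" "\<And>t. t \<in> {a..b} \<Longrightarrow> \<bar>k t\<bar> \<le> M1"
    "\<And>t. t \<in> {a..b} \<Longrightarrow> \<bar>k' t\<bar> \<le> M2" "\<And>t. t \<in> {a..b} \<Longrightarrow> \<bar>g t\<bar> \<le> M3"
    unfolding bounded_pos by force
  show ?thesis
  proof (rule absolutely_continuous_on_dominated[OF g(1), of "M1 + M2 * M3"])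
    fix u v assume uv: "u \<in> {a..b}" "v \<in> {a..b}" "u \<le> v"
    have "norm (k v - k u) \<le> M2 * norm (v - u)"
      by (rule field_differentiable_bound[of "{a..b}" k k'])
         (use k M uv in \<open>auto intro: has_field_derivative_at_within\<close>)
    then have kl: "\<bar>k v - k u\<bar> \<le> M2 * (v - u)" using uv by simp
    have "\<bar>k v * g v - k u * g u\<bar> = \<bar>k v * (g v - g u) + (k v - k u) * g u\<bar>"
      by (simp add: algebra_simps)
    also have "\<dots> \<le> \<bar>k v\<bar> * \<bar>g v - g u\<bar> + \<bar>k v - k u\<bar> * \<bar>g u\<bar>"
      by (metis abs_mult abs_triangle_ineq)
    also have "\<dots> \<le> M1 * \<bar>g v - g u\<bar> + (M2 * (v - u)) * M3"
      using M uv kl by (intro add_mono mult_mono) auto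
    also have "\<dots> \<le> (M1 + M2 * M3) * (\<bar>g v - g u\<bar> + (v - u))"
    proof -
      have "0 \<le> M1 * (v - u)" "0 \<le> M2 * M3 * \<bar>g v - g u\<bar>" using M uv by auto
      then show ?thesis by (simp add: algebra_simps)
    qed
    finally show "\<bar>k v * g v - k u * g u\<bar> \<le> (M1 + M2 * M3) * (\<bar>g v - g u\<bar> + (v - u))" .
  qed (use M in \<open>auto intro: add_pos_pos\<close>)
qed

section \<open>Energy estimates for damped oscillators\<close>

text \<open>Gronwall with integrating factor \<open>exp (c * t)\<close>: the excess of
  \<open>V\<close> over the equilibrium level \<open>D / c\<close> is at most a decaying
  exponential. The factor 2 leaves room for that excess, whatever the initial energy.\<close>

lemma eventually_le_of_dissipative:
  fixes V :: "real \<Rightarrow> real"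
  assumes "c > 0" "D > 0"
    and V: "\<And>t. t \<ge> T \<Longrightarrow> (V has_real_derivative V' t) (at t)"
    and le: "\<And>t. t \<ge> T \<Longrightarrow> V' t \<le> D - c * V t"
  shows "\<forall>\<^sub>F t in at_top. V t \<le> 2 * D / c"
proof -
  define W where "W t = (V t - D / c) * exp (c * t)" for t
  have mono: "W t \<le> W T" if "t \<ge> T" for t
  proof (rule DERIV_nonpos_imp_nonincreasing[OF that])
    fix s assume s: "T \<le> s" "s \<le> t"
    have "(W has_real_derivative (V' s - (D - c * V s)) * exp (c * s)) (at s)"
      unfolding W_def using \<open>c > 0\<close>
      by (auto intro!: derivative_eq_intros V s simp: field_simps)
    moreover have "(V' s - (D - c * V s)) * exp (c * s) \<le> 0"
      using le[OF s(1)] by (simp add: mult_le_0_iff)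
    ultimately show "\<exists>y. (W has_real_derivative y) (at s) \<and> y \<le> 0" by blast
  qed
  have "((\<lambda>t. W T * exp (- (c * t))) \<longlongrightarrow> 0) at_top"
    using \<open>c > 0\<close> by real_asymp
  then have "\<forall>\<^sub>F t in at_top. W T * exp (- (c * t)) < D / c"
    using \<open>c > 0\<close> \<open>D > 0\<close> by (intro order_tendstoD) auto
  with eventually_ge_at_top[of T] show ?thesis
  proof eventually_elim
    case (elim t)
    have "V t = D / c + W t * exp (- (c * t))"
      by (simp add: W_def exp_minus field_simps)
    also have "\<dots> \<le> D / c + W T * exp (- (c * t))"
      using mono[OF elim(1)] by simp
    also have "\<dots> \<le> 2 * D / c" using elim(2) by simp
    finally show ?case .
  qed
qed

text \<open>\<open>M\<close> weighs the forcing and \<open>c\<close> is the decay rate in the energy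
  inequality below, so the energy is eventually at most \<open>2 * M / c\<close> times the squared
  forcing bound. The factor \<open>1 + 1 / (2 * b)\<close> covers both \<open>v^2 \<le> V\<close>
  and \<open>q^2 \<le> V / (2 * b)\<close>. The gain depends on neither the forcing nor the initial
  data.\<close>

definition damped_gain :: "real \<Rightarrow> real \<Rightarrow> real" where
  "damped_gain a b =
    (let M = 4 / a + a / b; c = min (a / 3) (a * b / (2 * a\<^sup>2 + 2 * b))
     in sqrt (2 * M / c * (1 + 1 / (2 * b))))"

lemma damped_gain_pos:
  assumes "a > 0" "b > 0"
  shows "damped_gain a b > 0"
  using assms by (auto simp: damped_gain_def Let_def intro!: mult_pos_pos divide_pos_pos add_pos_pos)

text \<open>With \<open>V = v\<^sup>2 + (v + a q)\<^sup>2 + 2 b q\<^sup>2\<close> the terms in \<open>v q\<close> cancel in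
  \<open>V' = - 2 a v\<^sup>2 - 2 a b q\<^sup>2 + (4 v + 2 a q) g\<close>, so no case distinction on the
  discriminant is needed. Young's inequality then gives \<open>V' \<le> M g\<^sup>2 - c V\<close> with the constants
  of \<open>damped_gain\<close>.\<close>

lemma damped_oscillator_eventually_bounded:
  fixes a b :: real
  assumes "a > 0" "b > 0"
    and q: "\<And>t. t \<ge> 0 \<Longrightarrow> (q has_real_derivative v t) (at t within {0..})"
    and v: "\<And>t. t \<ge> 0 \<Longrightarrow> (v has_real_derivative g t - a * v t - b * q t) (at t within {0..})"
    and "B > 0" and g: "\<forall>\<^sub>F t in at_top. \<bar>g t\<bar> \<le> B"
  shows "\<forall>\<^sub>F t in at_top. \<bar>q t\<bar> \<le> damped_gain a b * B \<and> \<bar>v t\<bar> \<le> damped_gain a b * B"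
proof -
  define C where "C = damped_gain a b"
  define M where "M = 4 / a + a / b"
  define c where "c = min (a / 3) (a * b / (2 * a\<^sup>2 + 2 * b))"
  have C_eq: "C = sqrt (2 * M / c * (1 + 1 / (2 * b)))"
    by (simp add: C_def damped_gain_def Let_def M_def c_def)
  have "C > 0" unfolding C_def by (rule damped_gain_pos[OF assms(1,2)])
  have pos: "2 * a\<^sup>2 + 2 * b > 0" using assms by (simp add: add_pos_pos)
  have "M > 0" "c > 0" using assms pos by (auto simp: M_def c_def add_pos_pos)
  have "c \<le> a / 3" unfolding c_def by (rule min.cobounded1)
  then have c1: "3 * c \<le> a" by linarith
  have "c \<le> a * b / (2 * a\<^sup>2 + 2 * b)" by (simp add: c_def)
  then have c2: "(2 * a\<^sup>2 + 2 * b) * c \<le> a * b" using pos by (simp add: field_simps)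
  from g obtain T0 where T0: "\<And>t. t \<ge> T0 \<Longrightarrow> \<bar>g t\<bar> \<le> B"
    unfolding eventually_at_top_linorder by blast
  \<comment> \<open>Beyond 1 the point is interior to the half-line, so the derivatives within it
    are two-sided.\<close>
  define T where "T = max T0 1"
  have at: "at t within {0..} = at t" if "t \<ge> T" for t
    using that by (intro at_within_interior) (auto simp: T_def)
  define V V' where "V t = (v t)\<^sup>2 + (v t + a * q t)\<^sup>2 + 2 * b * (q t)\<^sup>2"
    and "V' t = - 2 * a * (v t)\<^sup>2 - 2 * a * b * (q t)\<^sup>2 + (4 * v t + 2 * a * q t) * g t" for t
  have "\<forall>\<^sub>F t in at_top. V t \<le> 2 * (M * B\<^sup>2) / c"
  proof (rule eventually_le_of_dissipative)
    fix t assume t: "t \<ge> T"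
    then have dq: "(q has_real_derivative v t) (at t)"
      and dv: "(v has_real_derivative g t - a * v t - b * q t) (at t)"
      using q[of t] v[of t] at[OF t] by (auto simp: T_def)
    show "(V has_real_derivative V' t) (at t)"
      unfolding V_def V'_def
      by (auto intro!: derivative_eq_intros dq dv simp: power2_eq_square algebra_simps)
    have "\<bar>g t\<bar> \<le> B" using t T0 by (simp add: T_def)
    then have g2: "(g t)\<^sup>2 \<le> B\<^sup>2" by (simp add: abs_le_square_iff[symmetric] \<open>B > 0\<close>)
    have y1: "4 * (v t * g t) \<le> a * (v t)\<^sup>2 + 4 / a * (g t)\<^sup>2"
    proof -
      have "0 \<le> (a * v t - 2 * g t)\<^sup>2 / a" using \<open>a > 0\<close> by simp
      also have "\<dots> = a * (v t)\<^sup>2 + 4 / a * (g t)\<^sup>2 - 4 * (v t * g t)"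
        using \<open>a > 0\<close> by (simp add: field_simps power2_eq_square)
      finally show ?thesis by simp
    qed
    have y2: "2 * a * (q t * g t) \<le> a * b * (q t)\<^sup>2 + a / b * (g t)\<^sup>2"
    proof -
      have "0 \<le> a * (b * q t - g t)\<^sup>2 / b" using \<open>a > 0\<close> \<open>b > 0\<close> by simp
      also have "\<dots> = a * b * (q t)\<^sup>2 + a / b * (g t)\<^sup>2 - 2 * a * (q t * g t)"
        using \<open>b > 0\<close> by (simp add: field_simps power2_eq_square)
      finally show ?thesis by simp
    qed
    \<comment> \<open>This is \<open>(v + a q)^2 \<le> 2 v^2 + 2 a^2 q^2\<close>. The two
      coefficients on the right are those against which the minimum in \<open>c\<close> was chosen:
      \<open>c\<close> times them is at most \<open>a\<close> and \<open>a * b\<close>.\<close>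
    have "V t \<le> 3 * (v t)\<^sup>2 + (2 * a\<^sup>2 + 2 * b) * (q t)\<^sup>2"
    proof -
      have "0 \<le> (v t - a * q t)\<^sup>2" by simp
      then show ?thesis by (simp add: V_def power2_eq_square algebra_simps)
    qed
    then have "c * V t \<le> c * (3 * (v t)\<^sup>2 + (2 * a\<^sup>2 + 2 * b) * (q t)\<^sup>2)"
      using \<open>c > 0\<close> by simp
    also have "\<dots> = 3 * c * (v t)\<^sup>2 + (2 * a\<^sup>2 + 2 * b) * c * (q t)\<^sup>2"
      by (simp add: algebra_simps)
    also have "\<dots> \<le> a * (v t)\<^sup>2 + a * b * (q t)\<^sup>2"
      using c1 c2 by (intro add_mono mult_right_mono) auto
    finally have cV: "c * V t \<le> a * (v t)\<^sup>2 + a * b * (q t)\<^sup>2" .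
    have "M * (g t)\<^sup>2 \<le> M * B\<^sup>2" using g2 \<open>M > 0\<close> by simp
    moreover have "M * (g t)\<^sup>2 = 4 / a * (g t)\<^sup>2 + a / b * (g t)\<^sup>2"
      by (simp add: M_def distrib_right)
    moreover have "V' t = - 2 * (a * (v t)\<^sup>2) - 2 * (a * b * (q t)\<^sup>2) +
        4 * (v t * g t) + 2 * a * (q t * g t)"
      by (simp add: V'_def algebra_simps)
    \<comment> \<open>Young's inequality uses up half of each of the damping terms
      \<open>2 a v^2\<close> and \<open>2 a b q^2\<close>; by \<open>cV\<close> the other half
      dominates \<open>c * V t\<close>.\<close>
    ultimately show "V' t \<le> M * B\<^sup>2 - c * V t" using y1 y2 cV by linarith
  qed (use \<open>c > 0\<close> \<open>M > 0\<close> \<open>B > 0\<close> in auto)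
  then show ?thesis unfolding C_def[symmetric]
  proof eventually_elim
    case (elim t)
    \<comment> \<open>The first summand bounds \<open>v^2\<close> and the second bounds
      \<open>q^2\<close>; both are nonnegative, so the sum bounds each.\<close>
    have C2: "(C * B)\<^sup>2 = 2 * (M * B\<^sup>2) / c + 2 * (M * B\<^sup>2) / c / (2 * b)"
      unfolding C_eq power_mult_distrib using \<open>M > 0\<close> \<open>c > 0\<close> \<open>b > 0\<close>
      by (simp add: field_simps)
    have nn: "0 \<le> 2 * (M * B\<^sup>2) / c" "0 \<le> 2 * (M * B\<^sup>2) / c / (2 * b)"
      using \<open>M > 0\<close> \<open>c > 0\<close> \<open>b > 0\<close> by auto
    have "0 \<le> 2 * b * (q t)\<^sup>2" using \<open>b > 0\<close> by simp
    then have "(v t)\<^sup>2 \<le> V t" by (simp add: V_def)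
    then have v2: "(v t)\<^sup>2 \<le> (C * B)\<^sup>2" using elim nn C2 by linarith
    have "2 * b * (q t)\<^sup>2 \<le> V t" by (simp add: V_def)
    then have "2 * b * (q t)\<^sup>2 \<le> 2 * (M * B\<^sup>2) / c" using elim by linarith
    then have "(q t)\<^sup>2 \<le> 2 * (M * B\<^sup>2) / c / (2 * b)"
      using \<open>b > 0\<close> by (rule_tac mult_imp_le_div_pos) (simp_all add: ac_simps)
    then have q2: "(q t)\<^sup>2 \<le> (C * B)\<^sup>2" using nn C2 by linarith
    show ?case
      using abs_le_square_iff[THEN iffD2, OF v2] abs_le_square_iff[THEN iffD2, OF q2]
        \<open>C > 0\<close> \<open>B > 0\<close> by simp
  qed
qed

section \<open>Limits superior expressed by eventual bounds\<close>

lemma limsup_abs_nonneg: "0 \<le> limsup_abs g"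
  unfolding limsup_abs_def by (rule le_Limsup) auto

lemma limsup_abs_less_infinity_iff_eventually:
  "limsup_abs g < \<infinity> \<longleftrightarrow> (\<exists>B>0. \<forall>\<^sub>F t in at_top. \<bar>g t\<bar> \<le> B)"
proof
  assume "limsup_abs g < \<infinity>"
  then obtain B where "limsup_abs g < ereal B"
    using less_PInf_Ex_of_nat by (metis ereal_dense2)
  then have "\<forall>\<^sub>F t in at_top. ereal \<bar>g t\<bar> < ereal B"
    unfolding limsup_abs_def by (rule Limsup_lessD)
  then have "\<forall>\<^sub>F t in at_top. \<bar>g t\<bar> \<le> max B 1" by eventually_elim auto
  then show "\<exists>B>0. \<forall>\<^sub>F t in at_top. \<bar>g t\<bar> \<le> B" by (intro exI[of _ "max B 1"]) auto
next
  assume "\<exists>B>0. \<forall>\<^sub>F t in at_top. \<bar>g t\<bar> \<le> B"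
  then obtain B where "\<forall>\<^sub>F t in at_top. \<bar>g t\<bar> \<le> B" by blast
  then have "limsup_abs g \<le> ereal B"
    unfolding limsup_abs_def by (intro Limsup_bounded) simp
  then show "limsup_abs g < \<infinity>" using le_less_trans by fastforce
qed

lemma limsup_abs_eq_0_iff_eventually:
  "limsup_abs g = 0 \<longleftrightarrow> (\<forall>B>0. \<forall>\<^sub>F t in at_top. \<bar>g t\<bar> \<le> B)"
proof (intro iffI allI impI)
  fix B :: real assume "limsup_abs g = 0" "B > 0"
  then have "limsup_abs g < ereal B" by simp
  then have "\<forall>\<^sub>F t in at_top. ereal \<bar>g t\<bar> < ereal B"
    unfolding limsup_abs_def by (rule Limsup_lessD)
  then show "\<forall>\<^sub>F t in at_top. \<bar>g t\<bar> \<le> B" by eventually_elim auto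
next
  assume *: "\<forall>B>0. \<forall>\<^sub>F t in at_top. \<bar>g t\<bar> \<le> B"
  have "limsup_abs g \<le> 0 + ereal B" if "B > 0" for B
    using * that unfolding limsup_abs_def by (intro Limsup_bounded) auto
  then have "limsup_abs g \<le> 0" by (rule ereal_le_epsilon2)
  then show "limsup_abs g = 0" using limsup_abs_nonneg[of g] by simp
qed

text \<open>Linearity in \<open>B\<close> is what lets one estimate serve both ends of the scale:
  arbitrarily small bounds transfer the value 0, a single bound transfers finiteness.\<close>

lemma limsup_abs_mono_eventually:
  assumes "K > 0" and "\<And>B. B > 0 \<Longrightarrow> \<forall>\<^sub>F t in at_top. \<bar>g t\<bar> \<le> B \<Longrightarrow> \<forall>\<^sub>F t in at_top. \<bar>h t\<bar> \<le> K * B"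
  shows "limsup_abs g = 0 \<Longrightarrow> limsup_abs h = 0" "limsup_abs g < \<infinity> \<Longrightarrow> limsup_abs h < \<infinity>"
proof -
  assume "limsup_abs g = 0"
  show "limsup_abs h = 0" unfolding limsup_abs_eq_0_iff_eventually
  proof (intro allI impI)
    fix B :: real assume "B > 0"
    then have "B / K > 0" using \<open>K > 0\<close> by simp
    moreover have "\<forall>\<^sub>F t in at_top. \<bar>g t\<bar> \<le> B / K"
      using \<open>limsup_abs g = 0\<close> \<open>B / K > 0\<close> by (simp add: limsup_abs_eq_0_iff_eventually)
    ultimately have "\<forall>\<^sub>F t in at_top. \<bar>h t\<bar> \<le> K * (B / K)" by (rule assms(2))
    then show "\<forall>\<^sub>F t in at_top. \<bar>h t\<bar> \<le> B" using \<open>K > 0\<close> by simp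
  qed
next
  assume "limsup_abs g < \<infinity>"
  then obtain B where "B > 0" "\<forall>\<^sub>F t in at_top. \<bar>g t\<bar> \<le> B"
    unfolding limsup_abs_less_infinity_iff_eventually by blast
  then have "K * B > 0" "\<forall>\<^sub>F t in at_top. \<bar>h t\<bar> \<le> K * B" using assms by auto
  then show "limsup_abs h < \<infinity>" unfolding limsup_abs_less_infinity_iff_eventually by blast
qed

section \<open>The convolution \<open>q\<close> and the integral identity for
  \<open>y2\<close>\<close>

lemma integral_has_real_derivative_halfline:
  fixes g :: "real \<Rightarrow> real"
  assumes g: "continuous_on {0..} g" and "t \<ge> 0"
  shows "((\<lambda>u. integral {0..u} g) has_real_derivative g t) (at t within {0..})"
proof -
  have "((\<lambda>u. integral {0..u} g) has_real_derivative g t) (at t within {0..t + 1})"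
    using assms by (intro integral_has_real_derivative continuous_on_subset[OF g]) auto
  moreover have "at t within {0..t + 1} = at t within {0..}"
    by (rule at_within_nhd[of _ "{..<t + 1}"]) auto
  ultimately show ?thesis by simp
qed

text \<open>Here \<open>q\<close> is the convolution of \<open>x\<close> with
  \<open>t exp(-t)\<close> and \<open>v + q\<close> that with \<open>exp(-t)\<close>, so together
  they express every kernel \<open>(\<alpha> + \<beta> t) exp(-t)\<close>. Expanding
  \<open>t - s\<close> moves \<open>t\<close> out of the integrals \<open>A\<close> and
  \<open>E\<close>, so nothing is differentiated under an integral sign.\<close>

lemma critically_damped_convolution:
  fixes x :: "real \<Rightarrow> real"
  assumes x: "continuous_on {0..} x"
  obtains q v where
    "\<And>t. t \<ge> 0 \<Longrightarrow> (q has_real_derivative v t) (at t within {0..})"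
    "\<And>t. t \<ge> 0 \<Longrightarrow> (v has_real_derivative x t - 2 * v t - q t) (at t within {0..})"
    "\<And>t \<alpha> \<beta>. t \<ge> 0 \<Longrightarrow> ((\<lambda>s. (\<alpha> + \<beta> * (t - s)) * exp (- (t - s)) * x s)
        has_integral \<alpha> * (v t + q t) + \<beta> * q t) {0..t}"
proof -
  define A where "A t = integral {0..t} (\<lambda>s. exp s * x s)" for t
  define E where "E t = integral {0..t} (\<lambda>s. s * exp s * x s)" for t
  define q where "q t = exp (- t) * (t * A t - E t)" for t
  define v where "v t = exp (- t) * A t - q t" for t
  have cA: "continuous_on {0..} (\<lambda>s. exp s * x s)" and cE: "continuous_on {0..} (\<lambda>s. s * exp s * x s)"
    by (intro continuous_intros x)+
  have dA: "(A has_real_derivative exp t * x t) (at t within {0..})"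
    and dE: "(E has_real_derivative t * exp t * x t) (at t within {0..})" if "t \<ge> 0" for t
    unfolding A_def E_def by (rule integral_has_real_derivative_halfline[OF _ that], fact)+
  have dq: "(q has_real_derivative v t) (at t within {0..})" if "t \<ge> 0" for t
    unfolding q_def v_def
    by (auto intro!: derivative_eq_intros dA dE that simp: algebra_simps)
  have dv: "(v has_real_derivative x t - 2 * v t - q t) (at t within {0..})" if "t \<ge> 0" for t
  proof -
    have "(v has_real_derivative exp (- t) * (exp t * x t) + - exp (- t) * A t - v t) (at t within {0..})"
      unfolding v_def[abs_def]
      by (rule derivative_eq_intros dA dq[unfolded v_def] that refl | simp)+
    moreover have "exp (- t) * (exp t * x t) + - exp (- t) * A t - v t = x t - 2 * v t - q t"
    proof -
      have "exp (- t) * (exp t * x t) = x t" by (simp add: exp_minus)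
      moreover have "exp (- t) * A t = v t + q t" by (simp add: v_def)
      ultimately show ?thesis by linarith
    qed
    ultimately show ?thesis by (simp only:)
  qed
  have int: "((\<lambda>s. (\<alpha> + \<beta> * (t - s)) * exp (- (t - s)) * x s)
        has_integral \<alpha> * (v t + q t) + \<beta> * q t) {0..t}" for t \<alpha> \<beta>
  proof -
    have "((\<lambda>s. exp s * x s) has_integral A t) {0..t}"
      "((\<lambda>s. s * exp s * x s) has_integral E t) {0..t}"
      unfolding A_def E_def
      by (intro integrable_integral integrable_continuous_real continuous_on_subset[OF cA]
          continuous_on_subset[OF cE]; force)+
    from has_integral_diff[OF has_integral_mult_right[OF this(1), of "(\<alpha> + \<beta> * t) * exp (- t)"]
        has_integral_mult_right[OF this(2), of "\<beta> * exp (- t)"]]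
    show ?thesis
    proof (rule has_integral_eq_rhs[OF has_integral_eq, rotated])
      show "\<alpha> * (v t + q t) + \<beta> * q t = (\<alpha> + \<beta> * t) * exp (- t) * A t - \<beta> * exp (- t) * E t"
        by (simp add: v_def q_def algebra_simps)
      show "(\<alpha> + \<beta> * t) * exp (- t) * (exp s * x s) - \<beta> * exp (- t) * (s * exp s * x s)
          = (\<alpha> + \<beta> * (t - s)) * exp (- (t - s)) * x s" for s
        by (simp add: exp_diff exp_minus field_simps)
    qed
  qed
  show thesis using that dq dv int by blast
qed

text \<open>The identity results from integrating the equation against the kernel of \<open>y2\<close> by parts
  twice, so that no derivative of \<open>x\<close> is left under the integral.\<close>

lemma y2_eq_of_solves_ode:
  assumes f: "locally_integrable_halfline f" and x: "solves_ode a b f \<xi>0 \<xi>1 x" and "t \<ge> 0"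
    and I: "((\<lambda>s. ((a - 2) + (b - a + 1) * (t - s)) * exp (- (t - s)) * x s) has_integral I) {0..t}"
  shows "y2 f t = x t - exp (- t) * (t * \<xi>1 - (t - 1) * \<xi>0 + a * t * \<xi>0) + I"
proof -
  from x obtain x' where dx: "\<And>t. t \<ge> 0 \<Longrightarrow> (x has_real_derivative x' t) (at t within {0..})"
    and cx': "continuous_on {0..} x'" and ac: "\<And>T. T \<ge> 0 \<Longrightarrow> absolutely_continuous_on {0..T} x'"
    and ae: "AE t\<in>{0..} in lebesgue. \<exists>x''. (x' has_real_derivative x'') (at t within {0..}) \<and>
             x'' + a * x' t + b * x t = f t"
    and init: "x 0 = \<xi>0" "x' 0 = \<xi>1"
    unfolding solves_ode_def by blast
  from ae obtain N where N: "N \<in> null_sets lebesgue"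
    and dx': "\<And>s. s \<ge> 0 \<Longrightarrow> s \<notin> N \<Longrightarrow>
      (x' has_real_derivative f s - a * x' s - b * x s) (at s within {0..})"
  proof (rule AE_E3)
    fix N assume N: "\<And>s. s \<in> space lebesgue - N \<Longrightarrow> s \<in> {0..} \<longrightarrow>
        (\<exists>x''. (x' has_real_derivative x'') (at s within {0..}) \<and> x'' + a * x' s + b * x s = f s)"
      and null: "N \<in> null_sets lebesgue"
    show thesis
    proof (rule that[OF null])
      fix s :: real assume "s \<ge> 0" "s \<notin> N"
      with N[of s] obtain x'' where "(x' has_real_derivative x'') (at s within {0..})"
        "x'' + a * x' s + b * x s = f s" by auto
      moreover from this have "x'' = f s - a * x' s - b * x s" by simp
      ultimately show "(x' has_real_derivative f s - a * x' s - b * x s) (at s within {0..})" by simp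
    qed
  qed
  have sub: "{0..t} \<subseteq> {0..}" by auto
  define k where "k s = (t - s) * exp (- (t - s))" for s
  define k1 where "k1 s = (t - s - 1) * exp (- (t - s))" for s
  have dk: "(k has_real_derivative k1 s) (at s within S)" for s S
    unfolding k_def k1_def
    by (auto intro!: derivative_eq_intros simp: algebra_simps)
  have dk1: "(k1 has_real_derivative (t - s - 2) * exp (- (t - s))) (at s within S)" for s S
    unfolding k1_def
    by (auto intro!: derivative_eq_intros simp: algebra_simps)
  have dxt: "(x has_real_derivative x' s) (at s within {0..t})" if "s \<in> {0..t}" for s
    using that by (intro DERIV_subset[OF dx sub]) auto
  \<comment> \<open>First integration by parts, for \<open>k * x'\<close>: the equation replaces the
    second derivative off \<open>N\<close>, and absolute continuity makes the null set
    harmless.\<close>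
  have "((\<lambda>s. k1 s * x' s + (f s - a * x' s - b * x s) * k s) has_integral
      k t * x' t - k 0 * x' 0) {0..t}"
  proof (rule absolutely_continuous_has_integral[OF \<open>t \<ge> 0\<close>, of _ N])
    show "absolutely_continuous_on {0..t} (\<lambda>s. k s * x' s)"
      by (rule absolutely_continuous_on_C1_mult[OF ac _ dk])
         (use \<open>t \<ge> 0\<close> in \<open>auto simp: k1_def intro!: continuous_intros continuous_on_subset[OF cx' sub]\<close>)
    show "negligible N" using N by (simp add: negligible_iff_null_sets)
    show "((\<lambda>s. k s * x' s) has_real_derivative k1 s * x' s + (f s - a * x' s - b * x s) * k s)
        (at s within {0..t})" if "s \<in> {0..t} - N" for s
      by (rule DERIV_mult[OF dk DERIV_subset[OF dx' sub]]) (use that in auto)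
  qed
  \<comment> \<open>Second integration by parts: the factor \<open>a * k - k1\<close> is exactly the
    one whose product rule cancels the \<open>x'\<close> terms left by the first.\<close>
  moreover have "((\<lambda>s. (a * k1 s - (t - s - 2) * exp (- (t - s))) * x s + x' s * (a * k s - k1 s))
      has_integral (a * k t - k1 t) * x t - (a * k 0 - k1 0) * x 0) {0..t}"
    by (rule fundamental_theorem_of_calculus[OF \<open>t \<ge> 0\<close>],
        unfold has_real_derivative_iff_has_vector_derivative[symmetric])
       (intro DERIV_mult DERIV_diff DERIV_cmult dk dk1 dxt)
  \<comment> \<open>Besides \<open>k * f\<close> only multiples of \<open>x\<close> remain, and the
    integrand of \<open>I\<close> is their negative.\<close>
  ultimately have "((\<lambda>s. (k1 s * x' s + (f s - a * x' s - b * x s) * k s) +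
       ((a * k1 s - (t - s - 2) * exp (- (t - s))) * x s + x' s * (a * k s - k1 s)) +
       ((a - 2) + (b - a + 1) * (t - s)) * exp (- (t - s)) * x s) has_integral
       (k t * x' t - k 0 * x' 0) + ((a * k t - k1 t) * x t - (a * k 0 - k1 0) * x 0) + I) {0..t}"
    by (intro has_integral_add I)
  then have "((\<lambda>s. k s * f s) has_integral
       x t - exp (- t) * (t * \<xi>1 - (t - 1) * \<xi>0 + a * t * \<xi>0) + I) {0..t}"
  proof (rule has_integral_eq_rhs[OF has_integral_eq, rotated])
    \<comment> \<open>Since \<open>k t = 0\<close> and \<open>k1 t = -1\<close>, the upper endpoint
      contributes just \<open>x t\<close>; the lower one gives the term with the initial
      data.\<close>
    show "x t - exp (- t) * (t * \<xi>1 - (t - 1) * \<xi>0 + a * t * \<xi>0) + I =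
       (k t * x' t - k 0 * x' 0) + ((a * k t - k1 t) * x t - (a * k 0 - k1 0) * x 0) + I"
      by (simp add: k_def k1_def init algebra_simps)
    show "(k1 s * x' s + (f s - a * x' s - b * x s) * k s) +
       ((a * k1 s - (t - s - 2) * exp (- (t - s))) * x s + x' s * (a * k s - k1 s)) +
       ((a - 2) + (b - a + 1) * (t - s)) * exp (- (t - s)) * x s = k s * f s" for s
      unfolding k_def k1_def by algebra
  qed
  \<comment> \<open>The value found so far is a gauge integral; absolute integrability identifies it
    with the Lebesgue integral in \<open>y2\<close>.\<close>
  moreover have "(\<lambda>s. k s * f s) absolutely_integrable_on {0..t}"
  proof (rule absolutely_integrable_bounded_measurable_product_real)
    have ck: "continuous_on {0..t} k" unfolding k_def by (intro continuous_intros)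
    show "k \<in> borel_measurable (lebesgue_on {0..t})"
      by (rule continuous_imp_measurable_on_sets_lebesgue[OF ck]) simp
    show "bounded (k ` {0..t})"
      using ck by (intro compact_imp_bounded compact_continuous_image) auto
    show "f absolutely_integrable_on {0..t}"
      using f \<open>t \<ge> 0\<close> unfolding locally_integrable_halfline_def by blast
  qed simp
  ultimately show ?thesis
    unfolding y2_def k_def[symmetric]
    by (subst set_lebesgue_integral_eq_integral) (auto dest: integral_unique)
qed

section \<open>Comparison of \<open>x\<close> and \<open>y2\<close> at infinity\<close>

theorem theorem10:
  fixes a b \<xi>0 \<xi>1 :: real and f x :: "real \<Rightarrow> real"
  assumes "a > 0" and "b > 0"
    and "locally_integrable_halfline f"
    and "solves_ode a b f \<xi>0 \<xi>1 x"
  shows "(limsup_abs (y2 f) = 0 \<longrightarrow> limsup_abs x = 0) \<and>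
         (0 < limsup_abs (y2 f) \<and> limsup_abs (y2 f) < \<infinity> \<longrightarrow>
            0 < limsup_abs x \<and> limsup_abs x < \<infinity>) \<and>
         (limsup_abs (y2 f) = \<infinity> \<longrightarrow> limsup_abs x = \<infinity>)"
proof -
  have "continuous_on {0..} x"
    using assms(4) unfolding solves_ode_def by (metis DERIV_continuous_on atLeast_iff)
  from critically_damped_convolution[OF this] obtain q v where
    dq: "\<And>t. t \<ge> 0 \<Longrightarrow> (q has_real_derivative v t) (at t within {0..})" and
    dv: "\<And>t. t \<ge> 0 \<Longrightarrow> (v has_real_derivative x t - 2 * v t - q t) (at t within {0..})" and
    int: "\<And>t \<alpha> \<beta>. t \<ge> 0 \<Longrightarrow> ((\<lambda>s. (\<alpha> + \<beta> * (t - s)) * exp (- (t - s)) * x s)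
        has_integral \<alpha> * (v t + q t) + \<beta> * q t) {0..t}" by blast
  define d where "d t = exp (- t) * (t * \<xi>1 - (t - 1) * \<xi>0 + a * t * \<xi>0)" for t
  \<comment> \<open>This is \<open>y2 + d\<close> on the half-line: with
    \<open>\<alpha> = a - 2\<close> and \<open>\<beta> = b - a + 1\<close> the convolution integral
    equals \<open>(a - 2) v + (b - 1) q\<close>.\<close>
  define g where "g t = x t + (a - 2) * v t + (b - 1) * q t" for t
  have y2: "y2 f t = g t - d t" if "t \<ge> 0" for t
    using y2_eq_of_solves_ode[OF assms(3,4) that int[OF that]]
    by (simp add: g_def d_def algebra_simps)
  have "(d \<longlongrightarrow> 0) at_top" unfolding d_def by real_asymp
  then have d0: "\<forall>\<^sub>F t in at_top. \<bar>d t\<bar> < B" if "B > 0" for B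
    using tendstoD[of d 0 at_top B] that by simp
  \<comment> \<open>As \<open>d\<close> vanishes at infinity, it can be charged to any bound
    \<open>B\<close> already at hand, which keeps the estimates below linear in
    \<open>B\<close>.\<close>
  have d: "\<forall>\<^sub>F t in at_top. \<bar>y2 f t - g t\<bar> \<le> B" if "B > 0" for B
    using eventually_ge_at_top[of 0] d0[OF that] by eventually_elim (simp add: y2)
  define m where "m = \<bar>a - 2\<bar> + \<bar>b - 1\<bar>"
  have m: "\<bar>(a - 2) * v t + (b - 1) * q t\<bar> \<le> m * R" if "\<bar>q t\<bar> \<le> R \<and> \<bar>v t\<bar> \<le> R" for t R
  proof -
    have "\<bar>(a - 2) * v t + (b - 1) * q t\<bar> \<le> \<bar>a - 2\<bar> * \<bar>v t\<bar> + \<bar>b - 1\<bar> * \<bar>q t\<bar>"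
      by (metis abs_mult abs_triangle_ineq)
    also have "\<dots> \<le> \<bar>a - 2\<bar> * R + \<bar>b - 1\<bar> * R"
      using that by (intro add_mono mult_left_mono) auto
    finally show ?thesis by (simp add: m_def distrib_right)
  qed
  define C where "C = damped_gain a b"
  define C' where "C' = damped_gain 2 1"
  have "C > 0" "C' > 0" using assms by (auto simp: C_def C'_def intro: damped_gain_pos)
  have "m \<ge> 0" by (simp add: m_def)
  \<comment> \<open>Eliminating \<open>x\<close> in favour of \<open>g\<close> turns the
    coefficients \<open>2, 1\<close> of the oscillator for \<open>q\<close> into
    \<open>a, b\<close>. Hence \<open>q\<close> and \<open>v\<close> can be bounded by
    \<open>y2\<close> as well as by \<open>x\<close>.\<close>
  have dv_g: "(v has_real_derivative g t - a * v t - b * q t) (at t within {0..})" if "t \<ge> 0" for t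
    using dv[OF that] by (simp add: g_def algebra_simps)
  have x_of_y: "\<forall>\<^sub>F t in at_top. \<bar>x t\<bar> \<le> (2 + m * (C * 2)) * B"
    if "B > 0" and y: "\<forall>\<^sub>F t in at_top. \<bar>y2 f t\<bar> \<le> B" for B
  proof -
    have g: "\<forall>\<^sub>F t in at_top. \<bar>g t\<bar> \<le> 2 * B"
      using y d[OF \<open>B > 0\<close>] by eventually_elim linarith
    have "\<forall>\<^sub>F t in at_top. \<bar>q t\<bar> \<le> C * (2 * B) \<and> \<bar>v t\<bar> \<le> C * (2 * B)"
      unfolding C_def
      by (rule damped_oscillator_eventually_bounded[OF assms(1,2) dq dv_g _ g]) (use \<open>B > 0\<close> in auto)
    with g show ?thesis
    proof eventually_elim
      case (elim t)
      have "\<bar>x t\<bar> \<le> \<bar>g t\<bar> + \<bar>(a - 2) * v t + (b - 1) * q t\<bar>" by (simp add: g_def)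
      also have "\<dots> \<le> 2 * B + m * (C * (2 * B))" using elim m[OF elim(2)] by linarith
      finally show ?case by (simp add: algebra_simps)
    qed
  qed
  have y_of_x: "\<forall>\<^sub>F t in at_top. \<bar>y2 f t\<bar> \<le> (2 + m * C') * B"
    if "B > 0" and xB: "\<forall>\<^sub>F t in at_top. \<bar>x t\<bar> \<le> B" for B
  proof -
    have "\<forall>\<^sub>F t in at_top. \<bar>q t\<bar> \<le> C' * B \<and> \<bar>v t\<bar> \<le> C' * B"
      unfolding C'_def
      by (rule damped_oscillator_eventually_bounded[OF _ _ dq _ \<open>B > 0\<close> xB]) (use dv in auto)
    with xB d[OF \<open>B > 0\<close>] show ?thesis
    proof eventually_elim
      case (elim t)
      have "\<bar>y2 f t\<bar> \<le> \<bar>y2 f t - g t\<bar> + (\<bar>x t\<bar> + \<bar>(a - 2) * v t + (b - 1) * q t\<bar>)"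
        by (simp add: g_def)
      also have "\<dots> \<le> B + (B + m * (C' * B))" using elim m[OF elim(3)] by linarith
      finally show ?case by (simp add: algebra_simps)
    qed
  qed
  have pos: "2 + m * (C * 2) > 0" "2 + m * C' > 0"
    using \<open>m \<ge> 0\<close> \<open>C > 0\<close> \<open>C' > 0\<close> by (simp_all add: add_pos_nonneg)
  note xy = limsup_abs_mono_eventually[OF pos(1) x_of_y]
    and yx = limsup_abs_mono_eventually[OF pos(2) y_of_x]
  \<comment> \<open>Contrapositives of \<open>yx\<close> give (iii) and the positivity in (ii);
    \<open>xy\<close> gives (i) and the finiteness in (ii).\<close>
  have "limsup_abs x = \<infinity>" if "limsup_abs (y2 f) = \<infinity>"
    using yx(2) that by force
  moreover have "0 < limsup_abs x" if "0 < limsup_abs (y2 f)"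
    using yx(1) limsup_abs_nonneg[of x] that by force
  ultimately show ?thesis using xy by blast
qed

end
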